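(* Let $\mathcal{H}$ be a complex Hilbert space, let $A\in\mathcal{B}(\mathcal{H})$ be normal, and let $r\geq 1$ be a real number. Then \[ w^{2r}(A)=\frac14\left\||A|^{2r}+|A^*|^{2r}\right\|+\frac12\, w\!\left(|A|^r|A^*|^r\right). \] That is, equality holds at $\theta=\tfrac12$ in the inequality $w^{2r}(A)\leq \frac14\left\| |A|^{4r\theta}+|A^*|^{4r(1-\theta)}\right\| +\frac12\, w\!\left(|A|^{2r\theta}|A^*|^{2r(1-\theta)}\right)$.
   Context: $\mathcal{B}(\mathcal{H})$ is the algebra of bounded linear operators on the complex Hilbert space $\mathcal{H}$, and $\|\cdot\|$ is the operator norm. For $T\in\mathcal{B}(\mathcal{H})$, the numerical radius is $w(T)=\sup\{|\langle Tx,x\rangle| : x\in\mathcal{H},\ \|x\|=1\}$, and $w^{2r}(T)$ means $(w(T))^{2r}$. $|T|=(T^*T)^{1/2}$, so $|T^*|=(TT^* )^{1/2}$. Real powers of positive operators are taken via the continuous functional calculus. *)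

theory Defs
  imports "HOL-Analysis.Analysis" "HOL-Computational_Algebra.Polynomial"
begin

class complex_vector = real_vector +
  fixes scaleC :: "complex \<Rightarrow> 'a \<Rightarrow> 'a"  (infixr \<open>*\<^sub>C\<close> 75)
  assumes scaleC_add_right: "a *\<^sub>C (x + y) = a *\<^sub>C x + a *\<^sub>C y"
    and scaleC_add_left: "(a + b) *\<^sub>C x = a *\<^sub>C x + b *\<^sub>C x"
    and scaleC_scaleC: "a *\<^sub>C (b *\<^sub>C x) = (a * b) *\<^sub>C x"
    and scaleC_one: "1 *\<^sub>C x = x"
    and scaleR_scaleC: "r *\<^sub>R x = complex_of_real r *\<^sub>C x"

text \<open>The inner product is linear in its first and conjugate-linear in its second argument.\<close>

class complex_inner = complex_vector + real_normed_vector +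
  fixes cinner :: "'a \<Rightarrow> 'a \<Rightarrow> complex"
  assumes cinner_commute: "cinner x y = cnj (cinner y x)"
    and cinner_add_left: "cinner (x + y) z = cinner x z + cinner y z"
    and cinner_scaleC_left: "cinner (c *\<^sub>C x) y = c * cinner x y"
    and cinner_ge_zero: "0 \<le> Re (cinner x x)"
    and cinner_eq_zero_iff: "cinner x x = 0 \<longleftrightarrow> x = 0"
    and norm_eq_sqrt_cinner: "norm x = sqrt (Re (cinner x x))"

class chilbert_space = complex_inner + complete_space

lemma norm_scaleC: "norm (c *\<^sub>C (x :: 'a :: complex_inner)) = cmod c * norm x"
proof -
  have im: "Im (cinner x x) = 0"
    using arg_cong[OF cinner_commute[of x x], of Im] by simp
  have "cinner (c *\<^sub>C x) (c *\<^sub>C x) = c * cnj c * cinner x x"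
    using cinner_commute[of x "c *\<^sub>C x"] cinner_commute[of x x]
    by (simp add: cinner_scaleC_left)
  also have "c * cnj c = complex_of_real ((cmod c)\<^sup>2)"
    by (rule complex_norm_square[symmetric])
  finally have "Re (cinner (c *\<^sub>C x) (c *\<^sub>C x)) = (cmod c)\<^sup>2 * Re (cinner x x)"
    using im by simp
  then show ?thesis
    by (simp add: norm_eq_sqrt_cinner real_sqrt_mult)
qed

text \<open>\<open>'a \<Rightarrow>\<^sub>L 'a\<close> is the type of bounded real-linear operators with the operator norm;
  \<open>B(H)\<close> is the subset of the complex-linear ones.\<close>

definition bounded_ops :: "('a :: complex_inner \<Rightarrow>\<^sub>L 'a) set" where
  "bounded_ops = {T. \<forall>c x. blinfun_apply T (c *\<^sub>C x) = c *\<^sub>C blinfun_apply T x}"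

lift_definition scalar_op :: "complex \<Rightarrow> ('a :: complex_inner \<Rightarrow>\<^sub>L 'a)" is "\<lambda>z x. z *\<^sub>C x"
proof (rule bounded_linear_intro)
  show "norm (z *\<^sub>C x) \<le> norm x * cmod z" for z and x :: 'a
    by (simp add: norm_scaleC mult.commute)
qed (simp_all add: scaleC_add_right scaleR_scaleC scaleC_scaleC mult.commute)

definition adj_op :: "('a :: chilbert_space \<Rightarrow>\<^sub>L 'a) \<Rightarrow> ('a \<Rightarrow>\<^sub>L 'a)" where
  "adj_op T = (THE S. S \<in> bounded_ops \<and>
     (\<forall>x y. cinner (blinfun_apply T x) y = cinner x (blinfun_apply S y)))"

definition normal_op :: "('a :: chilbert_space \<Rightarrow>\<^sub>L 'a) \<Rightarrow> bool" where
  "normal_op T \<longleftrightarrow> T o\<^sub>L adj_op T = adj_op T o\<^sub>L T"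

text \<open>Inserting \<open>0\<close> only matters on the zero space, where there are no unit vectors:
  the supremum is taken in \<open>[0, \<infinity>)\<close>.\<close>

definition numerical_radius :: "('a :: chilbert_space \<Rightarrow>\<^sub>L 'a) \<Rightarrow> real" where
  "numerical_radius T =
     Sup (insert 0 {cmod (cinner (blinfun_apply T x) x) | x. norm x = 1})"

definition op_spectrum :: "('a :: chilbert_space \<Rightarrow>\<^sub>L 'a) \<Rightarrow> complex set" where
  "op_spectrum T = {z. \<not> (\<exists>S \<in> bounded_ops.
     S o\<^sub>L (T - scalar_op z) = id_blinfun \<and> (T - scalar_op z) o\<^sub>L S = id_blinfun)}"

definition poly_op :: "real poly \<Rightarrow> ('a :: chilbert_space \<Rightarrow>\<^sub>L 'a) \<Rightarrow> ('a \<Rightarrow>\<^sub>L 'a)" where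
  "poly_op p T = (\<Sum>i\<le>degree p. coeff p i *\<^sub>R (((o\<^sub>L) T ^^ i) id_blinfun))"

text \<open>Continuous functional calculus of a self-adjoint operator \<open>T\<close> (whose spectrum is real)
  at a real function \<open>f\<close> continuous on the spectrum: the operator-norm limit of \<open>p\<^sub>n(T)\<close>
  for polynomials \<open>p\<^sub>n\<close> converging to \<open>f\<close> uniformly on the spectrum.\<close>

definition cfc :: "(real \<Rightarrow> real) \<Rightarrow> ('a :: chilbert_space \<Rightarrow>\<^sub>L 'a) \<Rightarrow> ('a \<Rightarrow>\<^sub>L 'a)" where
  "cfc f T = (THE S. \<exists>p :: nat \<Rightarrow> real poly.
     uniform_limit {t. complex_of_real t \<in> op_spectrum T} (\<lambda>n t. poly (p n) t) f sequentially \<and>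
     (\<lambda>n. poly_op (p n) T) \<longlonglongrightarrow> S)"

text \<open>For positive \<open>T\<close> and exponents \<open>s > 0\<close>, where \<open>t powr s\<close> is continuous on
  \<open>[0, \<infinity>)\<close> with value \<open>0\<close> at \<open>0\<close>.\<close>

definition op_powr :: "('a :: chilbert_space \<Rightarrow>\<^sub>L 'a) \<Rightarrow> real \<Rightarrow> ('a \<Rightarrow>\<^sub>L 'a)" where
  "op_powr T s = cfc (\<lambda>t. t powr s) T"

definition abs_op :: "('a :: chilbert_space \<Rightarrow>\<^sub>L 'a) \<Rightarrow> ('a \<Rightarrow>\<^sub>L 'a)" where
  "abs_op T = op_powr (adj_op T o\<^sub>L T) (1/2)"

end

theory Submission
  imports Defs "HOL-Computational_Algebra.Fundamental_Theorem_Algebra"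
begin

text \<open>
  Both sides equal \<open>\<parallel>A\<parallel>\<^bsup>2r\<^esup>\<close>. Since \<open>A\<close> is normal, \<open>A\<^sup>* A = A A\<^sup>*\<close> and therefore
  \<open>|A| = |A\<^sup>*| =: B\<close>. The right-hand side becomes
  \<open>1/4 \<parallel>2 B\<^bsup>2r\<^esup>\<parallel> + 1/2 w(B\<^bsup>r\<^esup> B\<^bsup>r\<^esup>) = 1/2 \<parallel>B\<^bsup>2r\<^esup>\<parallel> + 1/2 w(B\<^bsup>2r\<^esup>)\<close>. The two facts that finish
  the computation are \<open>w(T) = \<parallel>T\<parallel>\<close> for normal \<open>T\<close>, applied to \<open>A\<close> and to the positive operator
  \<open>B\<^bsup>2r\<^esup>\<close>, and \<open>\<parallel>P\<^bsup>s\<^esup>\<parallel> = \<parallel>P\<parallel>\<^bsup>s\<^esup>\<close> for positive \<open>P\<close>, which together with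
  \<open>\<parallel>A\<^sup>* A\<parallel> = \<parallel>A\<parallel>\<^sup>2\<close> gives \<open>\<parallel>B\<parallel> = \<parallel>A\<parallel>\<close> and \<open>\<parallel>B\<^bsup>2r\<^esup>\<parallel> = \<parallel>A\<parallel>\<^bsup>2r\<^esup>\<close>.

  The first fact (\<open>numerical_radius_normal\<close>) combines the crude bound \<open>\<parallel>T\<parallel> \<le> 2 w(T)\<close> with the power
  inequality \<open>w(T\<^sup>2) \<le> w(T)\<^sup>2\<close> and with \<open>\<parallel>T\<^sup>2\<parallel> = \<parallel>T\<parallel>\<^sup>2\<close> for normal \<open>T\<close>; iterating the squaring
  makes the factor \<open>2\<close> harmless.

  The second fact (\<open>norm_op_powr\<close>) and the existence of the powers rest on the isometry
  \<open>\<parallel>p(T)\<parallel> = sup \<bar>p\<bar>\<close> over the spectrum, for self-adjoint \<open>T\<close> and real polynomials \<open>p\<close>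
  (\<open>norm_poly_op_attained\<close>, \<open>poly_le_norm_poly_op\<close>). A self-adjoint operator is invertible exactly if
  it is bounded below, so its spectrum consists of approximate eigenvalues, and \<open>p(T)\<close> can be analysed by
  factoring real polynomials into linear and definite quadratic ones. The Hilbert space input, namely
  adjoints and inverses, comes from minimising one quadratic functional
  (\<open>quadratic_form_representation\<close>).
\<close>

section \<open>Inner products\<close>

instance chilbert_space \<subseteq> banach ..

lemma cinner_scaleC_right: "cinner x (c *\<^sub>C y) = cnj c * cinner (x :: 'a :: complex_inner) y"
  by (metis cinner_commute cinner_scaleC_left complex_cnj_mult)

lemma cinner_add_right: "cinner (x :: 'a :: complex_inner) (y + z) = cinner x y + cinner x z"
  by (metis cinner_commute cinner_add_left complex_cnj_add)

lemma cinner_scaleR_left: "cinner (a *\<^sub>R x) (y :: 'a :: complex_inner) = a *\<^sub>R cinner x y"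
  by (simp add: scaleR_scaleC cinner_scaleC_left scaleR_conv_of_real)

lemma cinner_scaleR_right: "cinner (x :: 'a :: complex_inner) (a *\<^sub>R y) = a *\<^sub>R cinner x y"
  by (simp add: scaleR_scaleC cinner_scaleC_right scaleR_conv_of_real)

lemma cinner_self: "cinner x (x :: 'a :: complex_inner) = complex_of_real ((norm x)\<^sup>2)"
proof -
  have "Im (cinner x x) = 0"
    using arg_cong[OF cinner_commute[of x x], of Im] by simp
  then show ?thesis
    by (simp add: complex_eq_iff norm_eq_sqrt_cinner cinner_ge_zero)
qed

lemma Re_cinner_commute: "Re (cinner y x) = Re (cinner x (y :: 'a :: complex_inner))"
  by (metis cinner_commute cnj.simps(1))

lemma norm_add_square:
  "(norm (x + y))\<^sup>2 = (norm x)\<^sup>2 + 2 * Re (cinner x y) + (norm (y :: 'a :: complex_inner))\<^sup>2"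
proof -
  have "complex_of_real ((norm (x + y))\<^sup>2) = cinner (x + y) (x + y)"
    by (simp only: cinner_self)
  also have "\<dots> = complex_of_real ((norm x)\<^sup>2) + cinner x y + cinner y x + complex_of_real ((norm y)\<^sup>2)"
    by (simp only: cinner_add_left cinner_add_right cinner_self[symmetric] ac_simps)
  finally have "Re (complex_of_real ((norm (x + y))\<^sup>2)) = Re \<dots>"
    by simp
  then show ?thesis by (simp add: Re_cinner_commute[of y x])
qed

lemma norm_scaleR_add_square:
  "(norm (x + t *\<^sub>R y))\<^sup>2 = (norm x)\<^sup>2 + 2 * t * Re (cinner x y) + t\<^sup>2 * (norm (y :: 'a :: complex_inner))\<^sup>2"
  by (simp add: norm_add_square cinner_scaleR_right power_mult_distrib)

text \<open>Cauchy-Schwarz, from \<open>0 \<le> \<parallel>\<parallel>y\<parallel> (\<zeta> x) - \<parallel>x\<parallel> y\<parallel>\<^sup>2\<close> with a scalar \<open>\<zeta>\<close>,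
  \<open>\<bar>\<zeta>\<bar> \<le> 1\<close>, that makes \<open>\<langle>\<zeta> x, y\<rangle>\<close>
  real and nonnegative.\<close>

lemma cmod_cinner_le: "cmod (cinner x y) \<le> norm x * norm (y :: 'a :: complex_inner)"
proof (cases "x = 0 \<or> y = 0")
  case True
  have "cinner 0 y = 0" using cinner_scaleR_left[of 0 0 y] by simp
  moreover have "cinner x 0 = 0" using cinner_scaleR_right[of x 0 0] by simp
  ultimately show ?thesis using True by auto
next
  case False
  define z where "z = cnj (sgn (cinner x y))"
  have z: "cmod z \<le> 1" by (simp add: z_def norm_sgn)
  have "z * cinner x y = complex_of_real (cmod (cinner x y))"
    by (cases "cinner x y = 0") (simp_all add: z_def sgn_eq complex_norm_square[symmetric] power2_eq_square mult.commute)
  then have re: "Re (cinner (z *\<^sub>C x) y) = cmod (cinner x y)"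
    by (simp add: cinner_scaleC_left)
  have nz: "norm (z *\<^sub>C x) \<le> norm x"
    using z by (simp add: norm_scaleC mult_left_le_one_le)
  have "0 \<le> (norm (norm y *\<^sub>R (z *\<^sub>C x) + (- norm x) *\<^sub>R y))\<^sup>2" by simp
  also have "\<dots> = (norm y)\<^sup>2 * (norm (z *\<^sub>C x))\<^sup>2 - 2 * norm x * norm y * cmod (cinner x y)
      + (norm x)\<^sup>2 * (norm y)\<^sup>2"
    by (simp only: norm_scaleR_add_square cinner_scaleR_left) (simp add: re power_mult_distrib algebra_simps)
  also have "\<dots> \<le> (norm y)\<^sup>2 * (norm x)\<^sup>2 - 2 * norm x * norm y * cmod (cinner x y)
      + (norm x)\<^sup>2 * (norm y)\<^sup>2"
    using nz by (intro add_right_mono diff_right_mono mult_left_mono power_mono) auto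
  finally have "norm x * norm y * cmod (cinner x y) \<le> norm x * norm y * (norm x * norm y)"
    by (simp add: power2_eq_square algebra_simps)
  then show ?thesis using False by simp
qed

interpretation cinner: bounded_bilinear "cinner :: 'a :: complex_inner \<Rightarrow> 'a \<Rightarrow> complex"
  by (rule bounded_bilinear.intro)
    (auto simp: cinner_add_left cinner_add_right cinner_scaleR_left cinner_scaleR_right
      intro!: exI[of _ 1] cmod_cinner_le)

lemma Re_cinner_le: "\<bar>Re (cinner x y)\<bar> \<le> norm x * norm (y :: 'a :: complex_inner)"
  using cmod_cinner_le abs_Re_le_cmod order_trans by blast

lemma eq_if_Re_cinner_eq:
  assumes "\<And>h. Re (cinner h x) = Re (cinner h (y :: 'a :: complex_inner))"
  shows "x = y"
proof -
  have "Re (cinner (x - y) (x - y)) = 0" using assms[of "x - y"] by (simp add: cinner.diff_right)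
  then show ?thesis by (simp add: cinner_self)
qed

text \<open>The real part of the inner product determines the complex one, because
  \<open>Im \<langle>x, y\<rangle> = - Re \<langle>\<i> x, y\<rangle>\<close>. So the variational argument below can be
  carried out for the real inner product and its outcome transferred to the complex one.\<close>

lemma cinner_eq_if_Re_cinner_eq:
  assumes "\<And>h. Re (cinner (T h) y) = Re (cinner h (z :: 'a :: complex_inner))"
    and "\<And>c x. T (c *\<^sub>C x) = c *\<^sub>C T x"
  shows "cinner (T x) (y :: 'a) = cinner x z"
proof -
  have "Im (cinner (T x) y) = Im (cinner x z)"
    using assms(1)[of "\<i> *\<^sub>C x"] by (simp add: assms(2) cinner_scaleC_left)
  then show ?thesis using assms(1) by (simp add: complex_eq_iff)
qed

section \<open>Minimising a quadratic functional\<close>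

text \<open>A Lax-Milgram lemma for the symmetric form \<open>Re \<langle>S h, S u\<rangle>\<close>: the solution \<open>u\<close> is the minimiser of
  \<open>\<phi> x = \<parallel>S x\<parallel>\<^sup>2 - 2 g x\<close>. By the parallelogram law a minimising sequence is Cauchy, and the
  derivative of \<open>\<phi>\<close> at the minimiser vanishes. For \<open>S = 1\<close> this is the Riesz representation
  theorem, which yields adjoints; for a self-adjoint \<open>S\<close> that is bounded below it yields
  surjectivity of \<open>S\<^sup>2\<close>, hence invertibility of \<open>S\<close>.\<close>

lemma quadratic_form_representation:
  fixes S :: "'a :: chilbert_space \<Rightarrow>\<^sub>L 'a" and g :: "'a \<Rightarrow> real"
  assumes g: "bounded_linear g" and c: "c > 0" and lower: "\<And>x. c * norm x \<le> norm (S x)"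
  obtains u where "\<And>h. Re (cinner (S h) (S u)) = g h"
proof -
  interpret g: bounded_linear g by (rule g)
  define \<phi> where "\<phi> x = (norm (S x))\<^sup>2 - 2 * g x" for x
  obtain K where K: "\<And>x. norm (g x) \<le> norm x * K" using g.bounded by blast
  have lowersq: "c\<^sup>2 * (norm x)\<^sup>2 \<le> (norm (S x))\<^sup>2" for x
    using power_mono[OF lower[of x], of 2] c by (simp add: power_mult_distrib)
  have "- (K\<^sup>2 / c\<^sup>2) \<le> \<phi> x" for x
  proof -
    have "0 \<le> (c * norm x - K / c)\<^sup>2" by simp
    also have "\<dots> = c\<^sup>2 * (norm x)\<^sup>2 - 2 * (norm x * K) + K\<^sup>2 / c\<^sup>2"
      using c by (simp add: power2_diff power_mult_distrib power_divide)
    finally show ?thesis using lowersq[of x] K[of x] unfolding \<phi>_def by simp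
  qed
  then have bdd: "bdd_below (range \<phi>)" by (rule bdd_belowI2)
  define m where "m = Inf (range \<phi>)"
  have m: "m \<le> \<phi> x" for x unfolding m_def by (rule cInf_lower) (auto simp: bdd)
  have "\<exists>x. \<phi> x < m + 1 / real (Suc n)" for n
    using cInf_lessD[of "range \<phi>" "m + 1 / real (Suc n)"] by (auto simp: m_def)
  then obtain X where X: "\<And>n. \<phi> (X n) < m + 1 / real (Suc n)" by metis
  have par: "c\<^sup>2 * (norm (x - y))\<^sup>2 \<le> 2 * (\<phi> x - m) + 2 * (\<phi> y - m)" for x y
  proof -
    have "\<phi> ((1/2) *\<^sub>R (x + y)) = (norm (S x))\<^sup>2 / 2 + (norm (S y))\<^sup>2 / 2 - (norm (S (x - y)))\<^sup>2 / 4 - g x - g y"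
    proof -
      have "(norm (S ((1/2) *\<^sub>R (x + y))))\<^sup>2 = (norm (S x + S y))\<^sup>2 / 4"
        by (simp add: blinfun.scaleR_right blinfun.add_right power_divide)
      moreover have "(norm (S x + S y))\<^sup>2 + (norm (S (x - y)))\<^sup>2 = 2 * (norm (S x))\<^sup>2 + 2 * (norm (S y))\<^sup>2"
        using norm_add_square[of "S x" "S y"] norm_scaleR_add_square[of "S x" "-1" "S y"]
        by (simp add: blinfun.diff_right)
      ultimately show ?thesis unfolding \<phi>_def g.add g.scaleR by (simp add: field_simps)
    qed
    then show ?thesis
      using m[of "(1/2) *\<^sub>R (x + y)"] lowersq[of "x - y"] unfolding \<phi>_def by simp
  qed
  have "Cauchy X"
  proof (rule CauchyI)
    fix e :: real assume "e > 0"
    then have "c\<^sup>2 * e\<^sup>2 / 4 > 0" using c by simp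
    then obtain N where N: "1 / real (Suc N) < c\<^sup>2 * e\<^sup>2 / 4"
      using nat_approx_posE by blast
    have small: "\<phi> (X n) - m < c\<^sup>2 * e\<^sup>2 / 4" if "n \<ge> N" for n
    proof -
      have "1 / real (Suc n) \<le> 1 / real (Suc N)" using that by (simp add: frac_le)
      then show ?thesis using X[of n] N by linarith
    qed
    have "norm (X k - X n) < e" if "k \<ge> N" "n \<ge> N" for k n
    proof -
      have "c\<^sup>2 * (norm (X k - X n))\<^sup>2 < c\<^sup>2 * e\<^sup>2"
        using par[of "X k" "X n"] small[OF that(1)] small[OF that(2)] by argo
      then show ?thesis using c \<open>e > 0\<close> by (simp add: power_less_imp_less_base)
    qed
    then show "\<exists>M. \<forall>k\<ge>M. \<forall>n\<ge>M. norm (X k - X n) < e" by blast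
  qed
  then obtain u where u: "X \<longlonglongrightarrow> u" using Cauchy_convergent_iff convergent_def by blast
  have "(\<lambda>n. \<phi> (X n)) \<longlonglongrightarrow> \<phi> u"
    unfolding \<phi>_def by (intro tendsto_intros g.tendsto u)
  moreover have "(\<lambda>n. m + 1 / real (Suc n)) \<longlonglongrightarrow> m + 0"
    by (intro tendsto_intros LIMSEQ_Suc lim_1_over_n)
  ultimately have "\<phi> u \<le> m + 0"
    by (rule LIMSEQ_le) (use X less_imp_le in blast)
  then have min: "\<phi> u \<le> \<phi> x" for x using m[of x] by linarith
  have "Re (cinner (S h) (S u)) = g h" for h
  proof (rule ccontr)
    \<comment> \<open>Here \<open>2 a\<close> is the derivative of \<open>\<phi>\<close> at \<open>u\<close> in the direction \<open>h\<close>; a step of length \<open>t\<close> against it lowers \<open>\<phi>\<close>.\<close>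
    define a b t where "a = Re (cinner (S u) (S h)) - g h" and "b = (norm (S h))\<^sup>2"
      and "t = - a / (b + 1)"
    assume "Re (cinner (S h) (S u)) \<noteq> g h"
    then have "a \<noteq> 0" by (simp add: a_def Re_cinner_commute[of "S h"])
    have "b \<ge> 0" by (simp add: b_def)
    have "\<phi> (u + t *\<^sub>R h) = \<phi> u + (2 * t * a + t\<^sup>2 * b)"
      unfolding \<phi>_def a_def b_def
      by (simp add: blinfun.bilinear_simps norm_scaleR_add_square g.add g.scaleR algebra_simps)
    then have "0 \<le> 2 * t * a + t\<^sup>2 * b" using min[of "u + t *\<^sub>R h"] by simp
    also have "\<dots> = - (a\<^sup>2 * (b + 2) / (b + 1)\<^sup>2)"
      using \<open>b \<ge> 0\<close> by (simp add: t_def field_simps power2_eq_square add_nonneg_eq_0_iff)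
    also have "\<dots> < 0" using \<open>a \<noteq> 0\<close> \<open>b \<ge> 0\<close> by simp
    finally show False by simp
  qed
  then show thesis by (rule that)
qed

section \<open>Adjoints\<close>

text \<open>A relation instead of the function \<^const>\<open>adj_op\<close>, which is meaningful only on \<^const>\<open>bounded_ops\<close>:
  being in the relation already forces complex linearity, so no separate hypothesis is carried along.\<close>

definition adjoint_pair :: "('a :: chilbert_space \<Rightarrow>\<^sub>L 'a) \<Rightarrow> ('a \<Rightarrow>\<^sub>L 'a) \<Rightarrow> bool" where
  "adjoint_pair T S \<longleftrightarrow> (\<forall>x y. cinner (T x) y = cinner x (S y))"

abbreviation "self_adjoint T \<equiv> adjoint_pair T T"

lemma adjoint_pair_sym: "adjoint_pair T S \<Longrightarrow> adjoint_pair S T"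
  unfolding adjoint_pair_def by (metis cinner_commute)

lemma adjoint_pair_unique:
  assumes "adjoint_pair T S" "adjoint_pair T R" shows "R = S"
  using assms by (intro blinfun_eqI eq_if_Re_cinner_eq) (metis adjoint_pair_def)

lemma bounded_ops_if_adjoint_pair:
  assumes "adjoint_pair T S" shows "T \<in> bounded_ops"
proof -
  have "cinner h (T (c *\<^sub>C x)) = cinner h (c *\<^sub>C T x)" for h c x
    using adjoint_pair_sym[OF assms] unfolding adjoint_pair_def by (metis cinner_scaleC_right)
  then show ?thesis by (auto simp: bounded_ops_def intro: eq_if_Re_cinner_eq)
qed

lemma norm_adjoint_apply_le:
  fixes T :: "'a :: chilbert_space \<Rightarrow>\<^sub>L 'a"
  assumes S: "\<And>x y. cinner (T x) y = cinner x (S y)"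
  shows "norm (S x) \<le> norm x * norm T"
proof -
  have "(norm (S x))\<^sup>2 = Re (cinner (T (S x)) x)" by (simp add: S cinner_self)
  also have "\<dots> \<le> norm (T (S x)) * norm x" using Re_cinner_le abs_le_D1 by blast
  also have "\<dots> \<le> (norm T * norm (S x)) * norm x"
    by (intro mult_right_mono norm_blinfun) simp
  finally have "norm (S x) * norm (S x) \<le> norm (S x) * (norm x * norm T)"
    by (simp add: power2_eq_square algebra_simps)
  then show ?thesis by (cases "S x = 0") simp_all
qed

lemma adjoint_exists:
  fixes T :: "'a :: chilbert_space \<Rightarrow>\<^sub>L 'a"
  assumes "T \<in> bounded_ops"
  obtains S where "adjoint_pair T S"
proof -
  have TC: "T (c *\<^sub>C x) = c *\<^sub>C T x" for c x using assms by (simp add: bounded_ops_def)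
  have "\<exists>u. \<forall>h. Re (cinner h u) = Re (cinner (T h) y)" for y
  proof -
    have "bounded_linear (\<lambda>h. Re (cinner (T h) y))"
      by (intro bounded_linear_compose[OF bounded_linear_Re]
          bounded_linear_compose[OF cinner.bounded_linear_left] blinfun.bounded_linear_right)
    from quadratic_form_representation[OF this, of 1 id_blinfun]
    show ?thesis by (auto simp: id_blinfun.rep_eq)
  qed
  then obtain S where "\<And>y h. Re (cinner (T h) y) = Re (cinner h (S y))" by metis
  then have S: "cinner (T x) y = cinner x (S y)" for x y
    by (rule cinner_eq_if_Re_cinner_eq) (simp add: TC)
  have "bounded_linear S"
  proof (rule bounded_linear_intro)
    show "S (x + y) = S x + S y" for x y
      by (rule eq_if_Re_cinner_eq) (simp add: cinner_add_right flip: S)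
    show "S (a *\<^sub>R x) = a *\<^sub>R S x" for a x
      by (rule eq_if_Re_cinner_eq) (simp add: cinner_scaleR_right flip: S)
    show "norm (S x) \<le> norm x * norm T" for x by (rule norm_adjoint_apply_le) (rule S)
  qed
  then have "adjoint_pair T (Blinfun S)" by (simp add: adjoint_pair_def bounded_linear_Blinfun_apply S)
  then show thesis by (rule that)
qed

lemma adj_op_eq:
  assumes "adjoint_pair T S" shows "adj_op T = S"
  unfolding adj_op_def
proof (rule the_equality)
  show "S \<in> bounded_ops \<and> (\<forall>x y. cinner (T x) y = cinner x (S y))"
    using assms bounded_ops_if_adjoint_pair[OF adjoint_pair_sym[OF assms]] by (simp add: adjoint_pair_def)
qed (use adjoint_pair_unique[OF assms] in \<open>simp add: adjoint_pair_def\<close>)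

lemma adjoint_pair_adj_op: "T \<in> bounded_ops \<Longrightarrow> adjoint_pair T (adj_op T)"
  by (metis adj_op_eq adjoint_exists)

text \<open>The C*-identity.\<close>

lemma norm_adjoint_compose:
  assumes "adjoint_pair T S" shows "norm (S o\<^sub>L T) = (norm T)\<^sup>2"
proof (rule antisym)
  have adj: "cinner (T x) y = cinner x (S y)" "cinner (S x) y = cinner x (T y)" for x y
    using assms adjoint_pair_sym[OF assms] by (simp_all add: adjoint_pair_def)
  have "norm S \<le> norm T"
    using norm_adjoint_apply_le[of T S] adj by (intro norm_blinfun_bound) (auto simp: mult.commute)
  then show "norm (S o\<^sub>L T) \<le> (norm T)\<^sup>2"
    using order_trans[OF norm_blinfun_compose mult_right_mono] by (simp add: power2_eq_square)
  have "norm (T x) \<le> sqrt (norm (S o\<^sub>L T)) * norm x" for x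
  proof -
    have "(norm (T x))\<^sup>2 = Re (cinner ((S o\<^sub>L T) x) x)" by (simp add: adj cinner_self)
    also have "\<dots> \<le> norm ((S o\<^sub>L T) x) * norm x" using Re_cinner_le abs_le_D1 by blast
    also have "\<dots> \<le> norm (S o\<^sub>L T) * norm x * norm x" by (intro mult_right_mono norm_blinfun) simp
    finally have "(norm (T x))\<^sup>2 \<le> (sqrt (norm (S o\<^sub>L T)) * norm x)\<^sup>2"
      by (simp add: power_mult_distrib) (simp add: power2_eq_square mult.assoc)
    then show ?thesis by (rule power2_le_imp_le) simp
  qed
  then have "norm T \<le> sqrt (norm (S o\<^sub>L T))" by (rule norm_blinfun_bound[rotated]) simp
  then show "(norm T)\<^sup>2 \<le> norm (S o\<^sub>L T)" by (metis norm_ge_zero power_mono real_sqrt_pow2)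
qed

definition bounded_below :: "('a :: chilbert_space \<Rightarrow>\<^sub>L 'a) \<Rightarrow> bool" where
  "bounded_below S \<longleftrightarrow> (\<exists>c>0. \<forall>x. c * norm x \<le> norm (S x))"

lemma bounded_below_compose:
  assumes "bounded_below S" "bounded_below T" shows "bounded_below (S o\<^sub>L T)"
proof -
  obtain c d where cd: "c > 0" "d > 0" "\<And>x. c * norm x \<le> norm (S x)" "\<And>x. d * norm x \<le> norm (T x)"
    using assms unfolding bounded_below_def by blast
  have "c * d * norm x \<le> norm (S (T x))" for x
    using order_trans[OF mult_left_mono[OF cd(4)[of x], of c] cd(3)[of "T x"]] cd(1)
    by (simp add: mult.assoc)
  then show ?thesis using cd(1,2) unfolding bounded_below_def
    by (intro exI[of _ "c * d"]) simp
qed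

text \<open>A left inverse gives the lower bound. Conversely, the representation of \<open>h \<mapsto> Re \<langle>h, y\<rangle>\<close> by the form
  \<open>Re \<langle>S h, S u\<rangle>\<close> solves \<open>S (S u) = y\<close>, so \<open>S\<close> is onto. This reduces the spectrum of a self-adjoint
  operator to approximate eigenvalues.\<close>

lemma self_adjoint_invertible_iff:
  fixes S :: "'a :: chilbert_space \<Rightarrow>\<^sub>L 'a"
  assumes S: "self_adjoint S"
  shows "(\<exists>R\<in>bounded_ops. R o\<^sub>L S = id_blinfun \<and> S o\<^sub>L R = id_blinfun) \<longleftrightarrow> bounded_below S"
proof
  assume "\<exists>R\<in>bounded_ops. R o\<^sub>L S = id_blinfun \<and> S o\<^sub>L R = id_blinfun"
  then obtain R where "R o\<^sub>L S = id_blinfun" by blast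
  then have R: "R (S x) = x" for x
    by (metis blinfun_apply_blinfun_compose id_blinfun.rep_eq id_apply)
  have "1 / (norm R + 1) * norm x \<le> norm (S x)" for x
  proof -
    have "norm x \<le> norm R * norm (S x)" by (metis R norm_blinfun)
    also have "\<dots> \<le> (norm R + 1) * norm (S x)" by (simp add: mult_right_mono)
    finally show ?thesis by (simp add: pos_divide_le_eq add_nonneg_pos mult.commute)
  qed
  moreover have "1 / (norm R + 1) > 0" by (simp add: add_nonneg_pos)
  ultimately show "bounded_below S" unfolding bounded_below_def by blast
next
  assume "bounded_below S"
  then obtain c where c: "c > 0" "\<And>x. c * norm x \<le> norm (S x)" unfolding bounded_below_def by blast
  have inj: "x = y" if "S x = S y" for x y
    using c(2)[of "x - y"] c(1) that by (simp add: blinfun.diff_right mult_le_0_iff)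
  have "\<exists>x. S x = y" for y
  proof -
    have "bounded_linear (\<lambda>h. Re (cinner h y))"
      by (intro bounded_linear_compose[OF bounded_linear_Re] cinner.bounded_linear_left)
    from quadratic_form_representation[OF this c] obtain u
      where "\<And>h. Re (cinner (S h) (S u)) = Re (cinner h y)" by blast
    then have "S (S u) = y"
      using S by (intro eq_if_Re_cinner_eq) (simp add: adjoint_pair_def)
    then show ?thesis by blast
  qed
  then obtain R where R: "\<And>y. S (R y) = y" by metis
  have RS: "R (S x) = x" for x by (rule inj) (rule R)
  have SC: "S (a *\<^sub>C x) = a *\<^sub>C S x" for a x
    using bounded_ops_if_adjoint_pair[OF S] by (simp add: bounded_ops_def)
  have "bounded_linear R"
  proof (rule bounded_linear_intro)
    show "R (x + y) = R x + R y" for x y by (rule inj) (simp add: R blinfun.add_right)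
    show "R (a *\<^sub>R x) = a *\<^sub>R R x" for a x by (rule inj) (simp add: R blinfun.scaleR_right)
    show "norm (R x) \<le> norm x * (1 / c)" for x
      using c(2)[of "R x"] c(1) by (simp add: R field_simps)
  qed
  then have [simp]: "blinfun_apply (Blinfun R) = R" by (rule bounded_linear_Blinfun_apply)
  have "R (a *\<^sub>C x) = a *\<^sub>C R x" for a x by (rule inj) (simp add: R SC)
  then have "Blinfun R \<in> bounded_ops" by (simp add: bounded_ops_def)
  moreover have "Blinfun R o\<^sub>L S = id_blinfun" "S o\<^sub>L Blinfun R = id_blinfun"
    by (auto intro!: blinfun_eqI simp: R RS id_blinfun.rep_eq)
  ultimately show "\<exists>R\<in>bounded_ops. R o\<^sub>L S = id_blinfun \<and> S o\<^sub>L R = id_blinfun" by blast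
qed

section \<open>The numerical radius of a normal operator\<close>

lemma numerical_radius_bdd_above:
  fixes T :: "'a :: chilbert_space \<Rightarrow>\<^sub>L 'a"
  shows "bdd_above (insert 0 {cmod (cinner (T x) x) | x. norm x = 1})"
proof (rule bdd_aboveI)
  fix y assume "y \<in> insert 0 {cmod (cinner (T x) x) | x. norm x = 1}"
  moreover have "cmod (cinner (T x) x) \<le> norm T" if "norm x = 1" for x
    using order_trans[OF cmod_cinner_le[of "T x" x]] norm_blinfun[of T x] that by simp
  ultimately show "y \<le> norm T" by auto
qed

lemma numerical_radius_nonneg: "0 \<le> numerical_radius T"
  unfolding numerical_radius_def by (rule cSup_upper[OF _ numerical_radius_bdd_above]) simp

lemma numerical_radius_le_norm: "numerical_radius T \<le> norm T"
proof -
  have "cmod (cinner (T x) x) \<le> norm T" if "norm x = 1" for x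
    using order_trans[OF cmod_cinner_le[of "T x" x]] norm_blinfun[of T x] that by simp
  then show ?thesis unfolding numerical_radius_def by (intro cSup_least) auto
qed

definition num_range_bound :: "('a :: chilbert_space \<Rightarrow>\<^sub>L 'a) \<Rightarrow> real \<Rightarrow> bool" where
  "num_range_bound T c \<longleftrightarrow> (\<forall>x. cmod (cinner (T x) x) \<le> c * (norm x)\<^sup>2)"

lemma num_range_bound_numerical_radius: "num_range_bound T (numerical_radius T)"
  unfolding num_range_bound_def
proof
  fix x
  show "cmod (cinner (T x) x) \<le> numerical_radius T * (norm x)\<^sup>2"
  proof (cases "x = 0")
    case False
    define y where "y = (1 / norm x) *\<^sub>R x"
    have "norm y = 1" using False by (simp add: y_def)
    then have "cmod (cinner (T y) y) \<le> numerical_radius T"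
      unfolding numerical_radius_def
      by (intro cSup_upper[OF _ numerical_radius_bdd_above]) auto
    moreover have "cinner (T y) y = (1 / (norm x)\<^sup>2) *\<^sub>R cinner (T x) x"
      by (simp add: y_def blinfun.scaleR_right cinner_scaleR_left cinner_scaleR_right power2_eq_square)
    ultimately show ?thesis using False by (simp add: pos_divide_le_eq)
  qed (simp add: cinner.zero_right)
qed

lemma num_range_bound_mono: "num_range_bound T c \<Longrightarrow> c \<le> d \<Longrightarrow> num_range_bound T d"
  unfolding num_range_bound_def using mult_right_mono[of c d] zero_le_power2 order_trans by blast

text \<open>The power inequality \<open>w(T\<^sup>2) \<le> w(T)\<^sup>2\<close>, by Pearcy's argument. After a rotation \<open>Z\<close> of \<open>T\<close> it
  suffices that \<open>c\<^sup>2 - Z\<^sup>2\<close> has nonnegative real part. Put \<open>u = (c + Z) x\<close> and \<open>v = (c - Z) x\<close>, so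
  that \<open>u + v = 2 c x\<close>. Then \<open>(c - Z) u = (c + Z) v = (c\<^sup>2 - Z\<^sup>2) x\<close>, and both \<open>c - Z\<close> and
  \<open>c + Z\<close> have nonnegative real part.\<close>

lemma num_range_bound_square:
  assumes T: "T \<in> bounded_ops" and c: "c > 0" and bound: "num_range_bound T c"
  shows "num_range_bound (T o\<^sub>L T) (c\<^sup>2)"
  unfolding num_range_bound_def
proof
  fix x
  have TC: "T (a *\<^sub>C y) = a *\<^sub>C T y" for a y using T by (simp add: bounded_ops_def)
  have key: "Re (z\<^sup>2 * cinner (T (T x)) x) \<le> c\<^sup>2 * (norm x)\<^sup>2" if z: "cmod z = 1" for z
  proof -
    define Z where "Z y = z *\<^sub>C T y" for y
    have Zlin: "Z (a + b) = Z a + Z b" "Z (a - b) = Z a - Z b" "Z (r *\<^sub>R a) = r *\<^sub>R Z a" for a b r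
    proof -
      show add: "Z (a + b) = Z a + Z b" for a b by (simp add: Z_def blinfun.add_right scaleC_add_right)
      show "Z (r *\<^sub>R a) = r *\<^sub>R Z a" for r a
        by (simp add: Z_def TC scaleR_scaleC scaleC_scaleC mult.commute)
      show "Z (a - b) = Z a - Z b" using add[of "a - b" b] by simp
    qed
    have Z: "cmod (cinner (Z y) y) \<le> c * (norm y)\<^sup>2" for y
      using bound z by (simp add: Z_def cinner_scaleC_left norm_mult num_range_bound_def)
    define u v where "u = c *\<^sub>R x + Z x" and "v = c *\<^sub>R x - Z x"
    have "0 \<le> Re (cinner (c *\<^sub>R u - Z u) u)"
      using Z[of u] complex_Re_le_cmod[of "cinner (Z u) u"]
      by (simp add: cinner.diff_left cinner_scaleR_left cinner_self)
    moreover have "0 \<le> Re (cinner (c *\<^sub>R v + Z v) v)"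
      using Z[of v] abs_Re_le_cmod[of "cinner (Z v) v"]
      by (simp add: cinner.add_left cinner_scaleR_left cinner_self)
    moreover have "c *\<^sub>R u - Z u = c\<^sup>2 *\<^sub>R x - Z (Z x)" "c *\<^sub>R v + Z v = c\<^sup>2 *\<^sub>R x - Z (Z x)"
      by (simp_all add: u_def v_def Zlin power2_eq_square algebra_simps)
    ultimately have "0 \<le> Re (cinner (c\<^sup>2 *\<^sub>R x - Z (Z x)) (u + v))"
      by (simp add: cinner.add_right)
    also have "u + v = (2 * c) *\<^sub>R x" by (simp add: u_def v_def scaleR_2 flip: scaleR_scaleR)
    finally have "0 \<le> Re (cinner (c\<^sup>2 *\<^sub>R x - Z (Z x)) x)"
      using c by (simp add: cinner_scaleR_right zero_le_mult_iff)
    moreover have "cinner (Z (Z x)) x = z\<^sup>2 * cinner (T (T x)) x"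
      by (simp add: Z_def TC scaleC_scaleC cinner_scaleC_left power2_eq_square)
    ultimately show ?thesis by (simp add: cinner.diff_left cinner_scaleR_left cinner_self)
  qed
  define s where "s = cinner (T (T x)) x"
  show "cmod (cinner ((T o\<^sub>L T) x) x) \<le> c\<^sup>2 * (norm x)\<^sup>2"
  proof (cases "s = 0")
    case False
    \<comment> \<open>The rotation enters squared, so its square must cancel the phase of \<open>s\<close>.\<close>
    define z where "z = csqrt (cnj (sgn s))"
    have zz: "z\<^sup>2 = cnj (sgn s)" by (simp add: z_def)
    have "cmod (z\<^sup>2) = 1" using False by (simp add: zz norm_sgn)
    then have "cmod z = 1" by (simp add: norm_power power2_eq_1_iff) (smt (verit) norm_ge_zero)
    moreover have "z\<^sup>2 * s = complex_of_real (cmod s)"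
      using False unfolding zz
      by (simp add: sgn_eq complex_norm_square[symmetric] mult.commute) (simp add: power2_eq_square)
    ultimately show ?thesis using key[of z] by (simp add: s_def)
  qed (use c in \<open>simp add: s_def\<close>)
qed

text \<open>Polarisation expresses \<open>\<langle>T x, y\<rangle>\<close> through values of the quadratic form \<open>\<langle>T z, z\<rangle>\<close>, at the price of
  a factor \<open>2\<close>. For normal operators this factor disappears on passing to high powers.\<close>

lemma norm_le_num_range_bound:
  assumes T: "T \<in> bounded_ops" and c: "c \<ge> 0" and bound: "num_range_bound T c"
  shows "norm T \<le> 2 * c"
proof -
  have TC: "T (a *\<^sub>C y) = a *\<^sub>C T y" for a y using T by (simp add: bounded_ops_def)
  have *: "cmod (cinner (T x) y + cinner (T y) x) \<le> c * ((norm x)\<^sup>2 + (norm y)\<^sup>2)" for x y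
  proof -
    have "2 * (cinner (T x) y + cinner (T y) x)
        = cinner (T (x + y)) (x + y) - cinner (T (x - y)) (x - y)"
      by (simp add: blinfun.add_right blinfun.diff_right cinner.add_left cinner.add_right
          cinner.diff_left cinner.diff_right)
    then have "2 * cmod (cinner (T x) y + cinner (T y) x)
        = cmod (cinner (T (x + y)) (x + y) - cinner (T (x - y)) (x - y))"
      by (metis norm_mult norm_numeral)
    also have "\<dots> \<le> cmod (cinner (T (x + y)) (x + y)) + cmod (cinner (T (x - y)) (x - y))"
      by (rule norm_triangle_ineq4)
    also have "\<dots> \<le> c * (norm (x + y))\<^sup>2 + c * (norm (x - y))\<^sup>2"
      using bound by (intro add_mono) (simp_all add: num_range_bound_def)
    also have "\<dots> = c * ((norm (x + y))\<^sup>2 + (norm (x - y))\<^sup>2)"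
      by (simp add: distrib_left)
    also have "(norm (x + y))\<^sup>2 + (norm (x - y))\<^sup>2 = 2 * ((norm x)\<^sup>2 + (norm y)\<^sup>2)"
      using norm_add_square[of x y] norm_scaleR_add_square[of x "-1" y] by simp
    finally show ?thesis by argo
  qed
  have pol: "cmod (cinner (T x) y) \<le> c * ((norm x)\<^sup>2 + (norm y)\<^sup>2)" for x y
  proof -
    have "2 * cinner (T x) y = (cinner (T x) y + cinner (T y) x)
        + \<i> * (cinner (T x) (\<i> *\<^sub>C y) + cinner (T (\<i> *\<^sub>C y)) x)"
      by (simp add: TC cinner_scaleC_left cinner_scaleC_right algebra_simps)
    then have "2 * cmod (cinner (T x) y) = cmod \<dots>" by (metis norm_mult norm_numeral)
    also have "\<dots> \<le> cmod (cinner (T x) y + cinner (T y) x)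
        + cmod (cinner (T x) (\<i> *\<^sub>C y) + cinner (T (\<i> *\<^sub>C y)) x)"
      by (rule order_trans[OF norm_triangle_ineq]) (simp add: norm_mult)
    also have "\<dots> \<le> 2 * (c * ((norm x)\<^sup>2 + (norm y)\<^sup>2))"
      using *[of x y] *[of x "\<i> *\<^sub>C y"] by (simp add: norm_scaleC)
    finally show ?thesis by simp
  qed
  have bd: "norm (T x) \<le> 2 * c * norm x" for x
  proof (cases "T x = 0 \<or> x = 0")
    case True
    then show ?thesis using c by (auto simp: blinfun.zero_right)
  next
    case False
    define y where "y = (norm x / norm (T x)) *\<^sub>R T x"
    have "cmod (cinner (T x) y) = norm x * norm (T x)"
      using False by (simp add: y_def cinner_scaleR_right cinner_self norm_power) (simp add: power2_eq_square)
    moreover have "norm y = norm x" using False by (simp add: y_def)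
    ultimately have "norm x * norm (T x) \<le> norm x * (2 * c * norm x)"
      using pol[of x y] by (simp add: power2_eq_square algebra_simps)
    then show ?thesis using False by simp
  qed
  show ?thesis using c bd by (intro norm_blinfun_bound) auto
qed

lemma adjoint_pair_compose:
  "adjoint_pair T S \<Longrightarrow> adjoint_pair U V \<Longrightarrow> adjoint_pair (T o\<^sub>L U) (V o\<^sub>L S)"
  by (simp add: adjoint_pair_def)

text \<open>Normality means \<open>\<parallel>S y\<parallel> = \<parallel>T y\<parallel>\<close> for all \<open>y\<close>, so \<open>T\<^sup>2\<close> and \<open>S T\<close> have the same norm, and the
  C*-identity applies.\<close>

lemma norm_square_normal:
  assumes "adjoint_pair T S" and "T o\<^sub>L S = S o\<^sub>L T"
  shows "(norm T)\<^sup>2 \<le> norm (T o\<^sub>L T)"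
proof -
  have comm: "T (S x) = S (T x)" for x using assms(2) by (metis blinfun_apply_blinfun_compose)
  have adj: "cinner (T x) y = cinner x (S y)" "cinner (S x) y = cinner x (T y)" for x y
    using assms(1) adjoint_pair_sym[OF assms(1)] by (simp_all add: adjoint_pair_def)
  have "(norm (S y))\<^sup>2 = (norm (T y))\<^sup>2" for y
  proof -
    have "cinner (S y) (S y) = cinner (T y) (T y)" by (simp add: adj comm)
    then show ?thesis by (metis cinner_self of_real_eq_iff)
  qed
  then have eq: "norm (S y) = norm (T y)" for y by (simp add: power2_eq_iff_nonneg)
  have "norm ((S o\<^sub>L T) x) \<le> norm (T o\<^sub>L T) * norm x" for x
    using norm_blinfun[of "T o\<^sub>L T" x] by (simp add: eq)
  then have "norm (S o\<^sub>L T) \<le> norm (T o\<^sub>L T)" by (intro norm_blinfun_bound) auto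
  then show ?thesis by (simp add: norm_adjoint_compose[OF assms(1)])
qed

text \<open>Squaring \<open>k\<close> times: \<open>\<parallel>T\<parallel>\<^bsup>n\<^esup> \<le> \<parallel>T\<^bsup>n\<^esup>\<parallel> \<le> 2 w(T\<^bsup>n\<^esup>) \<le> 2 c\<^bsup>n\<^esup>\<close> for \<open>n = 2\<^bsup>k\<^esup>\<close>.\<close>

lemma norm_power_le_num_range_bound:
  assumes "adjoint_pair T S" "T o\<^sub>L S = S o\<^sub>L T" "c > 0" "num_range_bound T c"
  shows "norm T ^ (2 ^ k) \<le> 2 * c ^ (2 ^ k)"
  using assms
proof (induction k arbitrary: T S c)
  case 0
  then show ?case
    using norm_le_num_range_bound[OF bounded_ops_if_adjoint_pair[OF 0(1)], of c] by simp
next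
  case (Suc k)
  have comm: "(T o\<^sub>L T) o\<^sub>L (S o\<^sub>L S) = (S o\<^sub>L S) o\<^sub>L (T o\<^sub>L T)"
  proof -
    have "T (S x) = S (T x)" for x using Suc.prems(2) by (metis blinfun_apply_blinfun_compose)
    then show ?thesis by (intro blinfun_eqI) simp
  qed
  have "norm (T o\<^sub>L T) ^ (2 ^ k) \<le> 2 * (c\<^sup>2) ^ (2 ^ k)"
  proof (rule Suc.IH[OF adjoint_pair_compose[OF Suc.prems(1,1)] comm])
    show "num_range_bound (T o\<^sub>L T) (c\<^sup>2)"
      using bounded_ops_if_adjoint_pair[OF Suc.prems(1)] Suc.prems(3,4) by (rule num_range_bound_square)
  qed (use Suc.prems(3) in simp)
  moreover have "((norm T)\<^sup>2) ^ (2 ^ k) \<le> norm (T o\<^sub>L T) ^ (2 ^ k)"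
    using norm_square_normal[OF Suc.prems(1,2)] by (rule power_mono) simp
  ultimately have "((norm T)\<^sup>2) ^ (2 ^ k) \<le> 2 * (c\<^sup>2) ^ (2 ^ k)"
    by (rule order_trans[rotated])
  then show ?case by (simp only: power_Suc power_mult)
qed

text \<open>Taking \<open>2\<^bsup>k\<^esup>\<close>-th roots in the previous estimate removes the factor \<open>2\<close> as \<open>k \<rightarrow> \<infinity>\<close>.\<close>

lemma numerical_radius_normal:
  assumes "adjoint_pair T S" "T o\<^sub>L S = S o\<^sub>L T"
  shows "numerical_radius T = norm T"
proof (rule antisym[OF numerical_radius_le_norm])
  show "norm T \<le> numerical_radius T"
  proof (rule dense_ge)
    fix c assume c: "numerical_radius T < c"
    then have "c > 0" using numerical_radius_nonneg le_less_trans by blast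
    show "norm T \<le> c"
    proof (rule ccontr)
      assume "\<not> norm T \<le> c"
      then have "1 < norm T / c" using \<open>c > 0\<close> by simp
      then obtain n where "2 < (norm T / c) ^ n" using real_arch_pow by blast
      also have "\<dots> \<le> (norm T / c) ^ (2 ^ n)"
        using \<open>1 < norm T / c\<close> by (intro power_increasing) (simp_all add: less_imp_le)
      also have "\<dots> \<le> 2"
        using norm_power_le_num_range_bound[OF assms \<open>c > 0\<close>, of n] \<open>c > 0\<close> c
          num_range_bound_mono[OF num_range_bound_numerical_radius, of T c]
        by (simp add: power_divide pos_divide_le_eq)
      finally show False by simp
    qed
  qed
qed

section \<open>Polynomials of a self-adjoint operator\<close>

lemma poly_op_eq_sum:
  assumes "degree p \<le> n"
  shows "poly_op p T = (\<Sum>i\<le>n. coeff p i *\<^sub>R (((o\<^sub>L) T ^^ i) id_blinfun))"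
  unfolding poly_op_def
  using assms by (intro sum.mono_neutral_left) (auto simp: coeff_eq_0)

lemma poly_op_0 [simp]: "poly_op 0 T = 0"
  by (simp add: poly_op_def)

lemma poly_op_pCons: "poly_op (pCons a p) T = a *\<^sub>R id_blinfun + (T o\<^sub>L poly_op p T)"
proof -
  interpret bounded_linear "(o\<^sub>L) T" by (rule bounded_bilinear.bounded_linear_right[OF bounded_bilinear_blinfun_compose])
  have "poly_op (pCons a p) T
      = (\<Sum>i\<le>Suc (degree p). coeff (pCons a p) i *\<^sub>R (((o\<^sub>L) T ^^ i) id_blinfun))"
    by (rule poly_op_eq_sum) (rule degree_pCons_le)
  also have "\<dots> = a *\<^sub>R id_blinfun + (\<Sum>i\<le>degree p. coeff p i *\<^sub>R (T o\<^sub>L (((o\<^sub>L) T ^^ i) id_blinfun)))"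
    by (subst sum.atMost_Suc_shift) simp
  also have "(\<Sum>i\<le>degree p. coeff p i *\<^sub>R (T o\<^sub>L (((o\<^sub>L) T ^^ i) id_blinfun))) = T o\<^sub>L poly_op p T"
    by (simp add: poly_op_def sum scaleR)
  finally show ?thesis .
qed

lemma poly_op_add: "poly_op (p + q) T = poly_op p T + poly_op q T"
proof -
  define n where "n = max (degree p) (degree q)"
  have "degree (p + q) \<le> n" "degree p \<le> n" "degree q \<le> n"
    unfolding n_def by (simp_all add: degree_add_le)
  then show ?thesis by (simp add: poly_op_eq_sum scaleR_add_left sum.distrib)
qed

lemma poly_op_smult: "poly_op (smult a p) T = a *\<^sub>R poly_op p T"
  using poly_op_eq_sum[of "smult a p" "degree p" T]
  by (simp add: degree_smult_le poly_op_def scaleR_sum_right)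

lemma poly_op_diff: "poly_op (p - q) T = poly_op p T - poly_op q T"
  using poly_op_add[of "p - q" q T] by simp

lemma poly_op_mult: "poly_op (p * q) T = poly_op p T o\<^sub>L poly_op q T"
proof (induction p)
  case (pCons a p)
  show ?case
    by (rule blinfun_eqI)
      (simp add: poly_op_add poly_op_smult poly_op_pCons pCons.IH blinfun.bilinear_simps)
qed (simp add: blinfun_eqI)

lemma poly_op_const: "poly_op [:a:] T = a *\<^sub>R id_blinfun"
  by (simp add: poly_op_pCons blinfun_eqI)

lemma poly_op_commute: "poly_op p T o\<^sub>L poly_op q T = poly_op q T o\<^sub>L poly_op p T"
  by (simp flip: poly_op_mult add: mult.commute)

lemma poly_op_X: "poly_op [:0, 1:] T = T"
  by (rule blinfun_eqI) (simp add: poly_op_pCons blinfun.bilinear_simps)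

lemma poly_op_linear: "poly_op [:- t, 1:] T = T - scalar_op (complex_of_real t)"
  by (rule blinfun_eqI) (simp add: poly_op_pCons blinfun.bilinear_simps scalar_op.rep_eq scaleR_scaleC)

lemma self_adjoint_poly_op:
  assumes "self_adjoint T" shows "self_adjoint (poly_op p T)"
proof (induction p)
  case (pCons a p)
  have "T (poly_op p T x) = poly_op p T (T x)" for x
    using poly_op_commute[of p T "[:0, 1:]"] by (metis blinfun_apply_blinfun_compose poly_op_X)
  then show ?case using assms pCons.IH
    by (simp add: adjoint_pair_def poly_op_pCons blinfun.bilinear_simps
        cinner.add_left cinner.add_right cinner_scaleR_left cinner_scaleR_right)
qed (simp add: adjoint_pair_def cinner.zero_left cinner.zero_right)

definition real_spectrum :: "('a :: chilbert_space \<Rightarrow>\<^sub>L 'a) \<Rightarrow> real set" where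
  "real_spectrum T = {t. complex_of_real t \<in> op_spectrum T}"

lemma real_spectrum_iff:
  assumes "self_adjoint T"
  shows "t \<in> real_spectrum T \<longleftrightarrow> \<not> bounded_below (poly_op [:- t, 1:] T)"
  using self_adjoint_invertible_iff[OF self_adjoint_poly_op[OF assms, of "[:- t, 1:]"]]
  unfolding real_spectrum_def op_spectrum_def mem_Collect_eq poly_op_linear[symmetric] by blast

text \<open>With \<open>L = T - a\<close> the operator is \<open>L\<^sup>2 + b\<^sup>2\<close>, whose quadratic form \<open>\<parallel>L x\<parallel>\<^sup>2 + b\<^sup>2 \<parallel>x\<parallel>\<^sup>2\<close> is at
  least \<open>b\<^sup>2 \<parallel>x\<parallel>\<^sup>2\<close>. This takes the place of the reality of the spectrum.\<close>

lemma bounded_below_quadratic: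
  assumes T: "self_adjoint T" and b: "b \<noteq> 0"
  shows "bounded_below (poly_op [:a\<^sup>2 + b\<^sup>2, - 2 * a, 1:] T)"
proof -
  let ?L = "poly_op [:- a, 1:] T" and ?Q = "poly_op [:a\<^sup>2 + b\<^sup>2, - 2 * a, 1:] T"
  have "[:a\<^sup>2 + b\<^sup>2, - 2 * a, 1:] = [:- a, 1:] * [:- a, 1:] + [:b\<^sup>2:]"
    by (simp add: power2_eq_square)
  then have Q: "?Q x = ?L (?L x) + b\<^sup>2 *\<^sub>R x" for x
    by (simp only: poly_op_add poly_op_mult poly_op_const)
      (simp add: blinfun.bilinear_simps)
  \<comment> \<open>Naming the operator keeps its polynomial from being rewritten.\<close>
  define Q where "Q = ?Q"
  have Q: "Q x = ?L (?L x) + b\<^sup>2 *\<^sub>R x" for x unfolding Q_def by (rule Q)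
  have "b\<^sup>2 * norm x \<le> norm (Q x)" for x
  proof -
    have "cinner (?L (?L x)) x = cinner (?L x) (?L x)"
      using self_adjoint_poly_op[OF T, of "[:- a, 1:]"] by (simp add: adjoint_pair_def)
    then have "b\<^sup>2 * (norm x)\<^sup>2 \<le> Re (cinner (Q x) x)"
      by (simp add: Q cinner.add_left cinner_scaleR_left cinner_self)
    also have "\<dots> \<le> norm (Q x) * norm x" using Re_cinner_le abs_le_D1 by blast
    finally show ?thesis by (cases "x = 0") (simp_all add: power2_eq_square)
  qed
  then show ?thesis using b unfolding bounded_below_def Q_def by (intro exI[of _ "b\<^sup>2"]) simp
qed

lemma poly_map_of_real: "poly (map_poly complex_of_real p) (complex_of_real x) = complex_of_real (poly p x)"
  by (induction p) (auto simp: map_poly_pCons)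

lemma map_poly_of_real_add:
  "map_poly complex_of_real (p + q) = map_poly complex_of_real p + map_poly complex_of_real q"
  by (rule poly_eqI) (simp add: coeff_map_poly)

lemma map_poly_of_real_mult:
  "map_poly complex_of_real (p * q) = map_poly complex_of_real p * map_poly complex_of_real q"
  by (rule poly_eqI) (simp add: coeff_map_poly coeff_mult)

text \<open>The remainder modulo the real quadratic with roots \<open>z\<close> and \<open>cnj z\<close> is a real polynomial of degree at
  most \<open>1\<close> that vanishes at the nonreal point \<open>z\<close>, hence it is zero.\<close>

lemma real_quadratic_dvd:
  fixes p :: "real poly"
  assumes z: "poly (map_poly complex_of_real p) z = 0" and im: "Im z \<noteq> 0"
  shows "[:(Re z)\<^sup>2 + (Im z)\<^sup>2, - 2 * Re z, 1:] dvd p"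
proof -
  define q where "q = [:(Re z)\<^sup>2 + (Im z)\<^sup>2, - 2 * Re z, 1:]"
  have q: "degree q = 2" "q \<noteq> 0" by (simp_all add: q_def)
  define s where "s = p mod q"
  have "degree s < 2 \<or> s = 0" using degree_mod_less[of q p] q by (auto simp: s_def)
  then have "degree s \<le> 1" by auto
  then have "s = [:coeff s 0, coeff s 1:]"
    by (intro poly_eqI) (auto simp: coeff_pCons coeff_eq_0 split: nat.split)
  then obtain c d where s: "s = [:c, d:]" by blast
  have "p = q * (p div q) + s" by (simp add: s_def)
  then have "map_poly complex_of_real p
      = map_poly complex_of_real q * map_poly complex_of_real (p div q) + map_poly complex_of_real s"
    by (metis map_poly_of_real_add map_poly_of_real_mult)
  moreover have "poly (map_poly complex_of_real q) z = 0"
    by (simp add: q_def map_poly_pCons complex_eq_iff power2_eq_square algebra_simps)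
  ultimately have "poly (map_poly complex_of_real s) z = 0" using z by simp
  then have "d * Im z = 0" "c + d * Re z = 0"
    by (auto simp: s map_poly_pCons complex_eq_iff algebra_simps)
  then have "s = 0" using im by (simp add: s)
  then show ?thesis unfolding q_def[symmetric] by (simp add: s_def dvd_eq_mod_eq_0)
qed

text \<open>The half of the spectral mapping theorem that the norm formula needs: \<open>0 \<in> \<sigma>(p(T))\<close> implies
  \<open>0 \<in> p(\<sigma>(T))\<close>. Over the reals \<open>p\<close> splits into linear and definite quadratic factors; the latter
  are bounded below at \<open>T\<close>, so some linear factor is not.\<close>

lemma real_spectrum_root:
  assumes T: "self_adjoint T"
  shows "p \<noteq> 0 \<Longrightarrow> \<not> bounded_below (poly_op p T) \<Longrightarrow> \<exists>t\<in>real_spectrum T. poly p t = 0"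
proof (induction "degree p" arbitrary: p rule: less_induct)
  case less
  have bb: "bounded_below (poly_op [:a:] T)" if "a \<noteq> 0" for a
    using that unfolding bounded_below_def
    by (intro exI[of _ "\<bar>a\<bar>"]) (simp add: poly_op_const blinfun.scaleR_left)
  have "degree p \<noteq> 0"
  proof
    assume "degree p = 0"
    then obtain a where "p = [:a:]" using degree_eq_zeroE by blast
    then show False using less.prems bb by auto
  qed
  then have "\<not> constant (poly (map_poly complex_of_real p))" by (simp add: constant_degree degree_map_poly)
  then obtain z where z: "poly (map_poly complex_of_real p) z = 0"
    using fundamental_theorem_of_algebra by blast
  obtain d q where p: "p = d * q" and d: "degree d > 0"
    and dT: "bounded_below (poly_op d T) \<or> (\<exists>t\<in>real_spectrum T. poly d t = 0)"
  proof (cases "Im z = 0")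
    case True
    then have "z = complex_of_real (Re z)" by (simp add: complex_eq_iff)
    then have "poly p (Re z) = 0" using z by (metis of_real_eq_0_iff poly_map_of_real)
    then obtain q where "p = [:- Re z, 1:] * q" by (metis dvdE poly_eq_0_iff_dvd)
    then show thesis using real_spectrum_iff[OF T, of "Re z"] by (intro that) auto
  next
    case False
    then obtain q where "p = [:(Re z)\<^sup>2 + (Im z)\<^sup>2, - 2 * Re z, 1:] * q"
      using real_quadratic_dvd[OF z] by blast
    then show thesis using bounded_below_quadratic[OF T False, of "Re z"] by (intro that) auto
  qed
  show ?case
  proof (cases "bounded_below (poly_op d T)")
    case False
    then show ?thesis using dT by (auto simp: p)
  next
    case True
    have "d \<noteq> 0" "q \<noteq> 0" using less.prems p by auto
    then have "degree q < degree p" using d by (simp add: p degree_mult_eq)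
    moreover have "\<not> bounded_below (poly_op q T)"
      using less.prems(2) bounded_below_compose[OF True] by (auto simp: p poly_op_mult)
    ultimately show ?thesis using less.hyps[of q] \<open>q \<noteq> 0\<close> by (auto simp: p)
  qed
qed

text \<open>One of \<open>\<plusminus>\<parallel>S\<parallel>\<close> is an approximate eigenvalue of a self-adjoint \<open>S\<close>, phrased through
  \<open>S\<^sup>2 - m\<^sup>2\<close> with \<open>m = \<parallel>S\<parallel>\<close>. The reason is
  \<open>\<parallel>(S\<^sup>2 - m\<^sup>2) x\<parallel>\<^sup>2 = \<parallel>S\<^sup>2 x\<parallel>\<^sup>2 - 2 m\<^sup>2 \<parallel>S x\<parallel>\<^sup>2 + m\<^sup>4 \<parallel>x\<parallel>\<^sup>2 \<le> m\<^sup>2 (m\<^sup>2 \<parallel>x\<parallel>\<^sup>2 - \<parallel>S x\<parallel>\<^sup>2)\<close>: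
  a lower bound on the left would push \<open>\<parallel>S x\<parallel>\<close> uniformly below \<open>m \<parallel>x\<parallel>\<close>.\<close>

lemma not_bounded_below_square_minus_norm:
  assumes S: "self_adjoint S" and "S \<noteq> 0"
  shows "\<not> bounded_below ((S o\<^sub>L S) - (norm S)\<^sup>2 *\<^sub>R id_blinfun)"
proof
  define m where "m = norm S"
  have m: "m > 0" using assms(2) by (simp add: m_def)
  assume "bounded_below ((S o\<^sub>L S) - (norm S)\<^sup>2 *\<^sub>R id_blinfun)"
  then obtain c where c: "c > 0" "\<And>x. c * norm x \<le> norm (S (S x) - m\<^sup>2 *\<^sub>R x)"
    unfolding bounded_below_def m_def by (auto simp: blinfun.bilinear_simps)
  define k where "k = m\<^sup>2 - c\<^sup>2 / m\<^sup>2"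
  have bound: "(norm (S x))\<^sup>2 \<le> k * (norm x)\<^sup>2" for x
  proof -
    have Sx: "norm (S (S x)) \<le> m * norm (S x)" by (simp add: m_def norm_blinfun)
    have "(c * norm x)\<^sup>2 \<le> (norm (S (S x) + (- m\<^sup>2) *\<^sub>R x))\<^sup>2"
      using c(2)[of x] c(1) by (intro power_mono) auto
    also have "\<dots> = (norm (S (S x)))\<^sup>2 - 2 * m\<^sup>2 * Re (cinner (S (S x)) x) + (m\<^sup>2)\<^sup>2 * (norm x)\<^sup>2"
      by (simp only: norm_scaleR_add_square) simp
    also have "Re (cinner (S (S x)) x) = (norm (S x))\<^sup>2"
      using S by (simp add: adjoint_pair_def cinner_self)
    also have "(norm (S (S x)))\<^sup>2 \<le> m\<^sup>2 * (norm (S x))\<^sup>2"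
      using power_mono[OF Sx, of 2] by (simp add: power_mult_distrib)
    finally have "m\<^sup>2 * (norm (S x))\<^sup>2 \<le> (m\<^sup>2)\<^sup>2 * (norm x)\<^sup>2 - c\<^sup>2 * (norm x)\<^sup>2"
      by (simp add: power_mult_distrib)
    then show ?thesis using m by (simp add: k_def field_simps power2_eq_square)
  qed
  have "k \<ge> 0"
  proof -
    obtain x where x: "S x \<noteq> 0" using assms(2) by (metis blinfun_eqI blinfun.zero_left)
    then have "0 < k * (norm x)\<^sup>2" using bound[of x] by (smt (verit) zero_less_norm_iff zero_less_power)
    then show ?thesis by (simp add: zero_less_mult_iff)
  qed
  have "norm (S x) \<le> sqrt k * norm x" for x
    using real_sqrt_le_mono[OF bound[of x]] by (simp add: real_sqrt_mult)
  then have "m \<le> sqrt k" unfolding m_def using \<open>k \<ge> 0\<close> by (intro norm_blinfun_bound) auto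
  then have "m\<^sup>2 \<le> k" using m \<open>k \<ge> 0\<close> by (metis less_imp_le power_mono real_sqrt_pow2)
  then show False using c(1) m by (simp add: k_def field_simps)
qed

text \<open>The operator \<open>R\<close> serves only to exclude the zero space, on which every spectrum is empty.\<close>

lemma real_spectrum_nonempty:
  fixes T R :: "'a :: chilbert_space \<Rightarrow>\<^sub>L 'a"
  assumes T: "self_adjoint T" and "R \<noteq> 0"
  shows "real_spectrum T \<noteq> {}"
proof (cases "T = 0")
  case True
  obtain x where "R x \<noteq> 0" using assms(2) by (metis blinfun_eqI blinfun.zero_left)
  then have "x \<noteq> 0" by (auto simp: blinfun.zero_right)
  then have "\<not> bounded_below T"
    unfolding bounded_below_def True by (force simp: mult_le_0_iff)
  then show ?thesis using real_spectrum_iff[OF T, of 0] by (auto simp: poly_op_X)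
next
  case False
  let ?q = "[:0, 1:] * [:0, 1:] - [:(norm T)\<^sup>2:]"
  have "\<not> bounded_below (poly_op ?q T)"
    using not_bounded_below_square_minus_norm[OF T False]
    by (simp only: poly_op_diff poly_op_mult poly_op_const poly_op_X not_False_eq_True)
  moreover have "?q \<noteq> 0" by simp
  ultimately show ?thesis using real_spectrum_root[OF T] by blast
qed

text \<open>With \<open>m = \<parallel>p(T)\<parallel>\<close>, the operator \<open>p(T)\<^sup>2 - m\<^sup>2 = (p\<^sup>2 - m\<^sup>2)(T)\<close> is not bounded below, so
  \<open>p\<^sup>2 - m\<^sup>2\<close> has a root in the spectrum. If that polynomial is zero, \<open>\<bar>p\<bar>\<close> is constantly \<open>m\<close> and any
  spectral point will do.\<close>

lemma norm_poly_op_attained: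
  assumes T: "self_adjoint T" and "poly_op p T \<noteq> 0"
  obtains t where "t \<in> real_spectrum T" "\<bar>poly p t\<bar> = norm (poly_op p T)"
proof -
  let ?m = "norm (poly_op p T)" and ?q = "p * p - [:(norm (poly_op p T))\<^sup>2:]"
  have nb: "\<not> bounded_below (poly_op ?q T)"
    using not_bounded_below_square_minus_norm[OF self_adjoint_poly_op[OF T] assms(2)]
    by (simp only: poly_op_diff poly_op_mult poly_op_const not_False_eq_True)
  show thesis
  proof (cases "?q = 0")
    case False
    then obtain t where t: "t \<in> real_spectrum T" "poly ?q t = 0" using real_spectrum_root[OF T _ nb] by blast
    from t(2) have "(poly p t)\<^sup>2 = ?m\<^sup>2" by (simp add: power2_eq_square)
    then have "\<bar>poly p t\<bar> = ?m" by (metis abs_norm_cancel power2_eq_iff abs_minus_cancel)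
    with t(1) show thesis by (rule that)
  next
    case True
    then have "p * p = [:?m\<^sup>2:]" by simp
    then have "(poly p t)\<^sup>2 = ?m\<^sup>2" for t by (metis poly_mult poly_const_conv power2_eq_square)
    then have "\<bar>poly p t\<bar> = ?m" for t by (metis abs_norm_cancel power2_eq_iff abs_minus_cancel)
    moreover obtain t where "t \<in> real_spectrum T"
      using real_spectrum_nonempty[OF T] assms(2) by blast
    ultimately show thesis by (metis that)
  qed
qed

lemma norm_poly_op_le:
  assumes "self_adjoint T" "\<And>t. t \<in> real_spectrum T \<Longrightarrow> \<bar>poly p t\<bar> \<le> c" "0 \<le> c"
  shows "norm (poly_op p T) \<le> c"
proof (cases "poly_op p T = 0")
  case False
  then obtain t where "t \<in> real_spectrum T" "\<bar>poly p t\<bar> = norm (poly_op p T)"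
    using norm_poly_op_attained[OF assms(1)] by blast
  then show ?thesis using assms(2)[of t] by simp
qed (use assms(3) in simp)

text \<open>Approximate eigenvectors of \<open>T\<close> for \<open>t\<close> are approximate eigenvectors of \<open>p(T)\<close> for \<open>p t\<close>, because
  \<open>p - p t\<close> is divisible by \<open>X - t\<close>.\<close>

lemma poly_le_norm_poly_op:
  assumes T: "self_adjoint T" and t: "t \<in> real_spectrum T"
  shows "\<bar>poly p t\<bar> \<le> norm (poly_op p T)"
proof (rule ccontr)
  define d where "d = \<bar>poly p t\<bar> - norm (poly_op p T)"
  assume "\<not> \<bar>poly p t\<bar> \<le> norm (poly_op p T)"
  then have d: "d > 0" by (simp add: d_def)
  have "poly (p - [:poly p t:]) t = 0" by simp
  then obtain q where q: "p - [:poly p t:] = [:- t, 1:] * q" by (metis dvdE poly_eq_0_iff_dvd)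
  then have "p = q * [:- t, 1:] + [:poly p t:]" by (simp add: algebra_simps)
  then have "poly_op p T = poly_op (q * [:- t, 1:] + [:poly p t:]) T" by simp
  then have pT: "poly_op p T x = poly_op q T (poly_op [:- t, 1:] T x) + poly p t *\<^sub>R x" for x
    by (simp only: poly_op_add poly_op_mult poly_op_const) (simp add: blinfun.bilinear_simps)
  have "d / (norm (poly_op q T) + 1) * norm x \<le> norm (poly_op [:- t, 1:] T x)" for x
  proof -
    let ?y = "poly_op [:- t, 1:] T x"
    have "\<bar>poly p t\<bar> * norm x = norm (poly_op p T x - poly_op q T ?y)" by (simp add: pT)
    also have "\<dots> \<le> norm (poly_op p T x) + norm (poly_op q T ?y)" by (rule norm_triangle_ineq4)
    also have "\<dots> \<le> norm (poly_op p T) * norm x + norm (poly_op q T) * norm ?y"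
      by (intro add_mono norm_blinfun)
    finally have "d * norm x \<le> norm (poly_op q T) * norm ?y" by (simp add: d_def algebra_simps)
    also have "\<dots> \<le> (norm (poly_op q T) + 1) * norm ?y" by (simp add: mult_right_mono)
    finally show ?thesis by (simp add: pos_divide_le_eq add_nonneg_pos mult.commute)
  qed
  then have "bounded_below (poly_op [:- t, 1:] T)"
    using d unfolding bounded_below_def by (metis add_nonneg_pos divide_pos_pos norm_ge_zero zero_less_one)
  then show False using t real_spectrum_iff[OF T] by simp
qed

section \<open>The continuous functional calculus\<close>

text \<open>The relation whose unique solution \<^const>\<open>cfc\<close> selects.\<close>

definition cfc_limit :: "(real \<Rightarrow> real) \<Rightarrow> ('a :: chilbert_space \<Rightarrow>\<^sub>L 'a) \<Rightarrow> ('a \<Rightarrow>\<^sub>L 'a) \<Rightarrow> bool" where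
  "cfc_limit f T S \<longleftrightarrow> (\<exists>p. uniform_limit (real_spectrum T) (\<lambda>n. poly (p n)) f sequentially
     \<and> (\<lambda>n. poly_op (p n) T) \<longlonglongrightarrow> S)"

text \<open>Together with the next lemma, the isometry \<open>\<parallel>f(T)\<parallel> = sup \<bar>f\<bar>\<close> over the spectrum, inherited from
  polynomials. Applied to a difference, it gives uniqueness of the limit.\<close>

lemma norm_cfc_limit_le:
  assumes T: "self_adjoint T" and S: "cfc_limit f T S"
    and f: "\<And>t. t \<in> real_spectrum T \<Longrightarrow> \<bar>f t\<bar> \<le> c" and c: "0 \<le> c"
  shows "norm S \<le> c"
proof (rule field_le_epsilon)
  fix e :: real assume e: "e > 0"
  obtain p where p: "uniform_limit (real_spectrum T) (\<lambda>n. poly (p n)) f sequentially"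
    "(\<lambda>n. poly_op (p n) T) \<longlonglongrightarrow> S"
    using S unfolding cfc_limit_def by blast
  have "\<forall>\<^sub>F n in sequentially. norm (poly_op (p n) T) \<le> c + e"
    using uniform_limitD[OF p(1) e]
  proof eventually_elim
    case (elim n)
    show ?case
    proof (rule norm_poly_op_le[OF T])
      fix t assume "t \<in> real_spectrum T"
      then have "\<bar>poly (p n) t - f t\<bar> < e" "\<bar>f t\<bar> \<le> c" using elim f by (auto simp: dist_real_def)
      then show "\<bar>poly (p n) t\<bar> \<le> c + e" by linarith
    qed (use c e in simp)
  qed
  then show "norm S \<le> c + e"
    by (intro tendsto_upperbound[OF tendsto_norm[OF p(2)]]) auto
qed

lemma le_norm_cfc_limit:
  assumes T: "self_adjoint T" and S: "cfc_limit f T S" and t: "t \<in> real_spectrum T"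
  shows "\<bar>f t\<bar> \<le> norm S"
proof -
  obtain p where p: "uniform_limit (real_spectrum T) (\<lambda>n. poly (p n)) f sequentially"
    "(\<lambda>n. poly_op (p n) T) \<longlonglongrightarrow> S"
    using S unfolding cfc_limit_def by blast
  show ?thesis
    by (rule LIMSEQ_le[OF tendsto_rabs[OF tendsto_uniform_limitI[OF p(1) t]] tendsto_norm[OF p(2)]])
      (use poly_le_norm_poly_op[OF T t] in blast)
qed

lemma cfc_limit_diff:
  assumes "cfc_limit f T S" "cfc_limit g T R"
  shows "cfc_limit (\<lambda>t. f t - g t) T (S - R)"
proof -
  obtain p q where
    "uniform_limit (real_spectrum T) (\<lambda>n. poly (p n)) f sequentially" "(\<lambda>n. poly_op (p n) T) \<longlonglongrightarrow> S"
    "uniform_limit (real_spectrum T) (\<lambda>n. poly (q n)) g sequentially" "(\<lambda>n. poly_op (q n) T) \<longlonglongrightarrow> R"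
    using assms unfolding cfc_limit_def by blast
  moreover have "poly (p n - q n) = (\<lambda>t. poly (p n) t - poly (q n) t)" for n by (simp add: fun_eq_iff)
  ultimately show ?thesis unfolding cfc_limit_def
    by (intro exI[of _ "\<lambda>n. p n - q n"]) (auto simp: poly_op_diff intro!: uniform_limit_minus tendsto_diff)
qed

lemma cfc_limit_mult:
  assumes T: "self_adjoint T" and f: "cfc_limit f T S" and g: "cfc_limit g T R"
  shows "cfc_limit (\<lambda>t. f t * g t) T (S o\<^sub>L R)"
proof -
  obtain p q where lim:
    "uniform_limit (real_spectrum T) (\<lambda>n. poly (p n)) f sequentially" "(\<lambda>n. poly_op (p n) T) \<longlonglongrightarrow> S"
    "uniform_limit (real_spectrum T) (\<lambda>n. poly (q n)) g sequentially" "(\<lambda>n. poly_op (q n) T) \<longlonglongrightarrow> R"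
    using f g unfolding cfc_limit_def by blast
  have "bounded (f ` real_spectrum T)" "bounded (g ` real_spectrum T)"
    using le_norm_cfc_limit[OF T f] le_norm_cfc_limit[OF T g] by (auto intro!: boundedI)
  then have "uniform_limit (real_spectrum T) (\<lambda>n t. poly (p n) t * poly (q n) t) (\<lambda>t. f t * g t) sequentially"
    using lim by (intro uniform_lim_mult) auto
  moreover have "(\<lambda>n. poly_op (p n) T o\<^sub>L poly_op (q n) T) \<longlonglongrightarrow> (S o\<^sub>L R)"
    by (rule bounded_bilinear.tendsto[OF bounded_bilinear_blinfun_compose lim(2,4)])
  moreover have "poly (p n * q n) = (\<lambda>t. poly (p n) t * poly (q n) t)" for n by (simp add: fun_eq_iff)
  ultimately show ?thesis unfolding cfc_limit_def
    by (intro exI[of _ "\<lambda>n. p n * q n"]) (simp add: poly_op_mult)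
qed

lemma cfc_eq:
  assumes T: "self_adjoint T" and S: "cfc_limit f T S"
  shows "cfc f T = S"
proof -
  have "R = S" if "cfc_limit f T R" for R
    using norm_cfc_limit_le[OF T cfc_limit_diff[OF that S], of 0] by simp
  then have "(THE S. cfc_limit f T S) = S" using S by (rule the_equality[rotated])
  then show ?thesis unfolding cfc_def cfc_limit_def real_spectrum_def .
qed

lemma self_adjoint_cfc_limit:
  assumes T: "self_adjoint T" and S: "cfc_limit f T S"
  shows "self_adjoint S"
proof -
  obtain p where p: "(\<lambda>n. poly_op (p n) T) \<longlonglongrightarrow> S"
    using S unfolding cfc_limit_def by blast
  have "cinner (S x) y = cinner x (S y)" for x y
  proof (rule LIMSEQ_unique)
    show "(\<lambda>n. cinner (poly_op (p n) T x) y) \<longlonglongrightarrow> cinner (S x) y"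
      by (intro cinner.tendsto blinfun.tendsto p tendsto_const)
    have "(\<lambda>n. cinner x (poly_op (p n) T y)) \<longlonglongrightarrow> cinner x (S y)"
      by (intro cinner.tendsto blinfun.tendsto p tendsto_const)
    then show "(\<lambda>n. cinner (poly_op (p n) T x) y) \<longlonglongrightarrow> cinner x (S y)"
      using self_adjoint_poly_op[OF T] by (simp add: adjoint_pair_def)
  qed
  then show ?thesis by (simp add: adjoint_pair_def)
qed

lemma real_polynomial_function_poly:
  assumes "real_polynomial_function (g :: real \<Rightarrow> real)"
  obtains p where "g = poly p"
proof -
  obtain a n where "g = (\<lambda>x. \<Sum>i\<le>n. a i * x ^ i)"
    using assms real_polynomial_function_iff_sum by blast
  then have "g = poly (\<Sum>i\<le>n. monom (a i) i)" by (simp add: fun_eq_iff poly_sum poly_monom)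
  then show thesis by (rule that)
qed

text \<open>Weierstrass approximation on an interval around the spectrum; the norm estimate for polynomials turns
  uniform convergence on the spectrum into a Cauchy sequence of operators.\<close>

lemma cfc_limit_exists:
  assumes T: "self_adjoint T" and K: "real_spectrum T \<subseteq> {a..b}" and f: "continuous_on {a..b} f"
  obtains S where "cfc_limit f T S"
proof -
  have "\<exists>p. \<forall>t\<in>real_spectrum T. \<bar>f t - poly p t\<bar> < 1 / real (Suc n)" for n
  proof -
    obtain g where "real_polynomial_function g" "\<And>t. t \<in> {a..b} \<Longrightarrow> \<bar>f t - g t\<bar> < 1 / real (Suc n)"
      using Stone_Weierstrass_real_polynomial_function[OF compact_Icc f, of "1 / real (Suc n)"] by auto
    then show ?thesis using K real_polynomial_function_poly[of g] by (metis subsetD)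
  qed
  then obtain p where p: "\<And>n t. t \<in> real_spectrum T \<Longrightarrow> \<bar>f t - poly (p n) t\<bar> < 1 / real (Suc n)" by metis
  have small: "\<bar>f t - poly (p n) t\<bar> < e" if "1 / real (Suc N) < e" "n \<ge> N" "t \<in> real_spectrum T" for N n e t
  proof -
    have "1 / real (Suc n) \<le> 1 / real (Suc N)" using that by (simp add: frac_le)
    then show ?thesis using p[of t n] that by linarith
  qed
  have lim: "uniform_limit (real_spectrum T) (\<lambda>n. poly (p n)) f sequentially"
  proof (rule uniform_limitI)
    fix e :: real assume "e > 0"
    then obtain N where "1 / real (Suc N) < e" using nat_approx_posE by blast
    then show "\<forall>\<^sub>F n in sequentially. \<forall>t\<in>real_spectrum T. dist (poly (p n) t) (f t) < e"
      using small by (intro eventually_sequentiallyI[of N]) (auto simp: dist_real_def abs_minus_commute)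
  qed
  have "Cauchy (\<lambda>n. poly_op (p n) T)"
  proof (rule CauchyI)
    fix e :: real assume "e > 0"
    then obtain N where N: "1 / real (Suc N) < e / 3" using nat_approx_posE[of "e / 3"] by auto
    have "norm (poly_op (p k) T - poly_op (p n) T) < e" if "k \<ge> N" "n \<ge> N" for k n
    proof -
      have "norm (poly_op (p k - p n) T) \<le> 2 * e / 3"
      proof (rule norm_poly_op_le[OF T])
        fix t assume "t \<in> real_spectrum T"
        then have "\<bar>f t - poly (p k) t\<bar> < e / 3" "\<bar>f t - poly (p n) t\<bar> < e / 3"
          using small[OF N] that by auto
        then show "\<bar>poly (p k - p n) t\<bar> \<le> 2 * e / 3" unfolding poly_diff by linarith
      qed (use \<open>e > 0\<close> in simp)
      then show ?thesis using \<open>e > 0\<close> by (simp add: poly_op_diff)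
    qed
    then show "\<exists>M. \<forall>k\<ge>M. \<forall>n\<ge>M. norm (poly_op (p k) T - poly_op (p n) T) < e" by blast
  qed
  then obtain S where "(\<lambda>n. poly_op (p n) T) \<longlonglongrightarrow> S"
    using Cauchy_convergent_iff convergent_def by blast
  then show thesis using lim that unfolding cfc_limit_def by blast
qed

section \<open>Powers of positive operators\<close>

definition positive_op :: "('a :: chilbert_space \<Rightarrow>\<^sub>L 'a) \<Rightarrow> bool" where
  "positive_op T \<longleftrightarrow> self_adjoint T \<and> (\<forall>x. 0 \<le> Re (cinner (T x) x))"

lemma positive_adjoint_compose:
  assumes "adjoint_pair T S" shows "positive_op (S o\<^sub>L T)"
proof -
  have "cinner (T x) y = cinner x (S y)" "cinner (S x) y = cinner x (T y)" for x y
    using assms adjoint_pair_sym[OF assms] by (simp_all add: adjoint_pair_def)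
  then show ?thesis by (simp add: positive_op_def adjoint_pair_def cinner_self)
qed

lemma real_spectrum_positive:
  assumes T: "positive_op T"
  shows "real_spectrum T \<subseteq> {0..norm T}"
proof
  fix t assume t: "t \<in> real_spectrum T"
  have sa: "self_adjoint T" using T by (simp add: positive_op_def)
  have "t \<le> norm T" using poly_le_norm_poly_op[OF sa t, of "[:0, 1:]"] by (simp add: poly_op_X)
  moreover have "0 \<le> t"
  proof (rule ccontr)
    assume "\<not> 0 \<le> t"
    let ?L = "poly_op [:- t, 1:] T"
    have "- t * norm x \<le> norm (?L x)" for x
    proof -
      have "?L x = T x - t *\<^sub>R x" by (simp add: poly_op_pCons blinfun.bilinear_simps)
      then have "- t * (norm x)\<^sup>2 \<le> Re (cinner (?L x) x)"
        using T by (simp add: positive_op_def cinner.diff_left cinner_scaleR_left cinner_self)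
      also have "\<dots> \<le> norm (?L x) * norm x" using Re_cinner_le abs_le_D1 by blast
      finally have "- t * norm x * norm x \<le> norm (?L x) * norm x" by (simp add: power2_eq_square)
      then show ?thesis by (cases "x = 0") (simp_all only: mult_le_cancel_right, auto)
    qed
    then have "bounded_below ?L" using \<open>\<not> 0 \<le> t\<close> unfolding bounded_below_def by (intro exI[of _ "- t"]) auto
    then show False using t real_spectrum_iff[OF sa] by simp
  qed
  ultimately show "t \<in> {0..norm T}" by simp
qed

lemma cfc_limit_op_powr:
  assumes "positive_op T" "s > 0"
  shows "cfc_limit (\<lambda>t. t powr s) T (op_powr T s)"
proof -
  have sa: "self_adjoint T" using assms by (simp add: positive_op_def)
  have "continuous_on {0..norm T} (\<lambda>t. t powr s)"
    using assms(2) by (intro continuous_on_powr' continuous_intros) auto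
  then obtain S where "cfc_limit (\<lambda>t. t powr s) T S"
    using cfc_limit_exists[OF sa real_spectrum_positive[OF assms(1)]] by blast
  then show ?thesis using cfc_eq[OF sa] unfolding op_powr_def by simp
qed

lemma op_powr_mult:
  assumes "positive_op T" "a > 0" "b > 0"
  shows "op_powr T a o\<^sub>L op_powr T b = op_powr T (a + b)"
proof -
  have sa: "self_adjoint T" using assms by (simp add: positive_op_def)
  have "cfc_limit (\<lambda>t. t powr (a + b)) T (op_powr T a o\<^sub>L op_powr T b)"
    using cfc_limit_mult[OF sa cfc_limit_op_powr[OF assms(1,2)] cfc_limit_op_powr[OF assms(1,3)]]
    by (simp add: powr_add)
  then show ?thesis using cfc_eq[OF sa] unfolding op_powr_def by simp
qed

text \<open>The power is the square of the self-adjoint operator \<open>T\<^bsup>s/2\<^esup>\<close>.\<close>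

lemma positive_op_powr:
  assumes "positive_op T" "s > 0"
  shows "positive_op (op_powr T s)"
proof -
  have "self_adjoint (op_powr T (s / 2))"
    using assms by (intro self_adjoint_cfc_limit[OF _ cfc_limit_op_powr]) (auto simp: positive_op_def)
  from positive_adjoint_compose[OF this] show ?thesis
    using op_powr_mult[OF assms(1), of "s / 2" "s / 2"] assms(2) by simp
qed

text \<open>The spectrum lies in \<open>[0, \<parallel>T\<parallel>]\<close> and, for \<open>T \<noteq> 0\<close>, contains \<open>\<parallel>T\<parallel>\<close>, where \<open>t powr s\<close> attains its maximum over
  this interval.\<close>

lemma norm_op_powr:
  assumes "positive_op T" "s > 0"
  shows "norm (op_powr T s) = norm T powr s"
proof (rule antisym)
  have sa: "self_adjoint T" using assms by (simp add: positive_op_def)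
  note K = real_spectrum_positive[OF assms(1)]
  show "norm (op_powr T s) \<le> norm T powr s"
  proof (rule norm_cfc_limit_le[OF sa cfc_limit_op_powr[OF assms]])
    fix t assume "t \<in> real_spectrum T"
    then show "\<bar>t powr s\<bar> \<le> norm T powr s" using K assms(2) by (auto intro!: powr_mono2)
  qed simp
  show "norm T powr s \<le> norm (op_powr T s)"
  proof (cases "T = 0")
    case False
    then obtain t where t: "t \<in> real_spectrum T" "\<bar>t\<bar> = norm T"
      using norm_poly_op_attained[OF sa, of "[:0, 1:]"] by (auto simp: poly_op_X)
    then have "t = norm T" using K by auto
    then show ?thesis using le_norm_cfc_limit[OF sa cfc_limit_op_powr[OF assms] t(1)] by simp
  qed simp
qed

section \<open>Equality for normal operators\<close>

theorem theorem5p1: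
  fixes A :: "'a :: chilbert_space \<Rightarrow>\<^sub>L 'a" and r :: real
  assumes "A \<in> bounded_ops"
    and "normal_op A"
    and "r \<ge> 1"
  shows "numerical_radius A powr (2 * r)
           = 1/4 * norm (op_powr (abs_op A) (2 * r) + op_powr (abs_op (adj_op A)) (2 * r))
             + 1/2 * numerical_radius (op_powr (abs_op A) r o\<^sub>L op_powr (abs_op (adj_op A)) r)
       \<and> (let \<theta> = 1/2 in
           numerical_radius A powr (2 * r)
           = 1/4 * norm (op_powr (abs_op A) (4 * r * \<theta>)
                         + op_powr (abs_op (adj_op A)) (4 * r * (1 - \<theta>)))
             + 1/2 * numerical_radius (op_powr (abs_op A) (2 * r * \<theta>)
                         o\<^sub>L op_powr (abs_op (adj_op A)) (2 * r * (1 - \<theta>))))"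
proof -
  define S where "S = adj_op A"
  have AS: "adjoint_pair A S" unfolding S_def using assms(1) by (rule adjoint_pair_adj_op)
  have comm: "A o\<^sub>L S = S o\<^sub>L A" using assms(2) by (simp add: normal_op_def S_def)
  define B where "B = abs_op A"
  have B: "B = op_powr (S o\<^sub>L A) (1/2)" by (simp add: B_def abs_op_def S_def)
  have B': "abs_op (adj_op A) = B"
    unfolding B abs_op_def S_def[symmetric] adj_op_eq[OF adjoint_pair_sym[OF AS]] comm ..
  have pos: "positive_op (S o\<^sub>L A)" using AS by (rule positive_adjoint_compose)
  have Bpos: "positive_op B" unfolding B using pos by (rule positive_op_powr) simp
  have normB: "norm B = norm A"
    unfolding B using norm_op_powr[OF pos, of "1/2"]
    by (simp add: norm_adjoint_compose[OF AS] powr_half_sqrt)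
  define C where "C = op_powr B (2 * r)"
  have normC: "norm C = norm A powr (2 * r)"
    unfolding C_def normB[symmetric] using Bpos by (rule norm_op_powr) (use assms(3) in simp)
  have "positive_op C" unfolding C_def using Bpos by (rule positive_op_powr) (use assms(3) in simp)
  then have wC: "numerical_radius C = norm C"
    by (intro numerical_radius_normal[of C C]) (simp_all add: positive_op_def)
  have CC: "op_powr B r o\<^sub>L op_powr B r = C"
    using op_powr_mult[OF Bpos, of r r] assms(3) by (simp add: C_def)
  have wA: "numerical_radius A = norm A" using AS comm by (rule numerical_radius_normal)
  have "norm (C + C) = 2 * norm C" by (simp flip: scaleR_2)
  then have "numerical_radius A powr (2 * r)
      = 1/4 * norm (op_powr B (2 * r) + op_powr B (2 * r))
        + 1/2 * numerical_radius (op_powr B r o\<^sub>L op_powr B r)"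
    by (simp add: CC wC wA normC flip: C_def)
  then show ?thesis by (simp add: Let_def B' flip: B_def)
qed

end
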